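(* Let $\gamma_1,\gamma_2\in\{1,-1\}$. For $t=1,2$ let $k_t$ be a positive integer and $\ell_t$ an integer with $0<\ell_t<k_t$ and $\ell_t\neq\frac{k_t}{2}$, and put $M_t(j)=\frac{k_t}{2}j(j-1)+\ell_t j$ for $j\in\mathbb{Z}$. Let $s^{\gamma_1,\gamma_2}(n)$, $n\ge 0$, be the coefficients of the power series expansion, for $|q|<1$, of $$H(q)=\prod_{m\ge 1}\frac{(1-q^{k_2m})(1+\gamma_2q^{k_2m-\ell_2})(1+\gamma_2q^{k_2(m-1)+\ell_2})}{(1-q^{k_1m})(1-\gamma_1q^{k_1m-\ell_1})(1-\gamma_1q^{k_1(m-1)+\ell_1})}=\sum_{n\ge 0}s^{\gamma_1,\gamma_2}(n)q^n,$$ and set $s^{\gamma_1,\gamma_2}(n)=0$ for $n<0$. Let $n$ be a positive integer. Then $$s^{\gamma_1,\gamma_2}(n)=\begin{cases}\Big(\sum_{j\in\mathbb{Z}\setminus\{0\}}-(-\gamma_1)^{j}\,s^{\gamma_1,\gamma_2}(n-M_1(j))\Big)+\gamma_2^{\,i} & \text{if } n=M_2(i)\text{ for some } i\in\mathbb{Z},\\[4pt] \sum_{j\in\mathbb{Z}\setminus\{0\}}-(-\gamma_1)^{j}\,s^{\gamma_1,\gamma_2}(n-M_1(j)) & \text{otherwise.}\end{cases}$$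
   Context: Under the assumptions on $(k_t,\ell_t)$ (the pairs are "not boundary cases": boundary cases are $\ell=0$, $\ell=k$, and $\ell=\frac{k}{2}$), the values $M_t(j)$, $j\in\mathbb{Z}$, are pairwise distinct, so the index $i$ with $n=M_2(i)$ is unique when it exists. The sums have only finitely many nonzero terms because $s^{\gamma_1,\gamma_2}$ vanishes at negative integers. *)

theory Defs
  imports "HOL-Complex_Analysis.Complex_Analysis"
begin

(* The integer division is exact, since j * (j - 1) is even; see of_int_M. *)
definition M :: "int \<Rightarrow> int \<Rightarrow> int \<Rightarrow> int" where
  "M k l j = k * (j * (j - 1)) div 2 + l * j"

lemma of_int_M: "real_of_int (M k l j) = real_of_int k / 2 * of_int j * (of_int j - 1) + of_int l * of_int j"
proof -
  have "even (k * (j * (j - 1)))" by simp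
  then have "real_of_int (k * (j * (j - 1)) div 2) = real_of_int (k * (j * (j - 1))) / 2"
    by (simp add: real_of_int_div)
  then show ?thesis unfolding M_def by simp
qed

definition H_factor :: "complex \<Rightarrow> complex \<Rightarrow> int \<Rightarrow> int \<Rightarrow> int \<Rightarrow> int \<Rightarrow> complex \<Rightarrow> nat \<Rightarrow> complex" where
  "H_factor \<gamma>1 \<gamma>2 k1 l1 k2 l2 q m =
     ((1 - q powi (k2 * int m)) * (1 + \<gamma>2 * q powi (k2 * int m - l2))
        * (1 + \<gamma>2 * q powi (k2 * (int m - 1) + l2)))
   / ((1 - q powi (k1 * int m)) * (1 - \<gamma>1 * q powi (k1 * int m - l1))
        * (1 - \<gamma>1 * q powi (k1 * (int m - 1) + l1)))"

(* prodinf starts at index 0, the product at m = 1. *)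
definition H :: "complex \<Rightarrow> complex \<Rightarrow> int \<Rightarrow> int \<Rightarrow> int \<Rightarrow> int \<Rightarrow> complex \<Rightarrow> complex" where
  "H \<gamma>1 \<gamma>2 k1 l1 k2 l2 q = (\<Prod>m. H_factor \<gamma>1 \<gamma>2 k1 l1 k2 l2 q (Suc m))"

(* The power series expansion of H at 0 converges to H on the whole unit disc; see sums_s. *)
definition s :: "complex \<Rightarrow> complex \<Rightarrow> int \<Rightarrow> int \<Rightarrow> int \<Rightarrow> int \<Rightarrow> int \<Rightarrow> complex" where
  "s \<gamma>1 \<gamma>2 k1 l1 k2 l2 n =
     (if n < 0 then 0 else fps_nth (fps_expansion (H \<gamma>1 \<gamma>2 k1 l1 k2 l2) 0) (nat n))"

lemma norm_prod3:
  fixes a b c :: complex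
  assumes "norm a \<le> t" "norm b \<le> t" "norm c \<le> t" "t \<le> 1"
  shows "norm ((1 + a) * (1 + b) * (1 + c) - 1) \<le> 7 * t"
proof -
  have t0: "0 \<le> t" using assms(1) norm_ge_zero order_trans by blast
  have ab: "norm (a * b) \<le> t"
    using mult_mono[of "norm a" t "norm b" 1] assms t0 by (simp add: norm_mult)
  have ac: "norm (a * c) \<le> t"
    using mult_mono[of "norm a" t "norm c" 1] assms t0 by (simp add: norm_mult)
  have bc: "norm (b * c) \<le> t"
    using mult_mono[of "norm b" t "norm c" 1] assms t0 by (simp add: norm_mult)
  have abc: "norm (a * b * c) \<le> t"
    using mult_mono[of "norm (a * b)" t "norm c" 1] ab assms t0 by (simp add: norm_mult)
  have "(1 + a) * (1 + b) * (1 + c) - 1 = a + b + c + a * b + a * c + b * c + a * b * c"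
    by (simp add: algebra_simps)
  also have "norm \<dots> \<le> norm a + norm b + norm c + norm (a * b) + norm (a * c) + norm (b * c) + norm (a * b * c)"
    by (intro order_trans[OF norm_triangle_ineq] add_mono order_refl)
  finally show ?thesis using assms ab ac bc abc by linarith
qed

lemma powi_bound:
  fixes q :: complex
  assumes "norm q \<le> r" "r < 1" "int m \<le> e"
  shows "norm (q powi e) \<le> r ^ m"
proof -
  have r0: "0 \<le> r" using assms(1) norm_ge_zero order_trans by blast
  have "norm (q powi e) = norm q ^ nat e"
    using assms(3) by (simp add: power_int_def norm_power)
  also have "\<dots> \<le> r ^ nat e" using assms(1) by (intro power_mono) auto
  also have "\<dots> \<le> r ^ m" using assms r0 by (intro power_decreasing) auto
  finally show ?thesis .
qed

context
  fixes \<gamma>1 \<gamma>2 :: complex and k1 l1 k2 l2 :: int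
  assumes g: "\<gamma>1 \<in> {1, - 1}" "\<gamma>2 \<in> {1, - 1}"
    and kl1: "0 < l1" "l1 < k1" and kl2: "0 < l2" "l2 < k2"
begin

lemma exponent_bounds:
  assumes "0 < l" "l < k"
  shows "int (Suc m) \<le> k * int (Suc m)" "int (Suc m) \<le> k * int (Suc m) - l"
        "int (Suc m) \<le> k * (int (Suc m) - 1) + l"
proof -
  have a: "2 * int m \<le> k * int m" using assms by (intro mult_right_mono) auto
  show "int (Suc m) \<le> k * int (Suc m)" "int (Suc m) \<le> k * int (Suc m) - l"
       "int (Suc m) \<le> k * (int (Suc m) - 1) + l"
    using a assms by (simp_all add: algebra_simps)
qed

lemma norm_one_plus_ge:
  fixes a :: complex
  assumes "norm a \<le> r"
  shows "1 - r \<le> norm (1 + a)"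
  using assms norm_triangle_ineq4[of "1 + a" a] by simp

lemma H_factor_bound:
  assumes q: "norm q \<le> r" and r: "r < 1"
  shows "norm (H_factor \<gamma>1 \<gamma>2 k1 l1 k2 l2 q (Suc m) - 1) \<le> 14 / (1 - r) ^ 3 * r ^ m"
    and "1 - q powi (k1 * int (Suc m)) \<noteq> 0" "1 - \<gamma>1 * q powi (k1 * int (Suc m) - l1) \<noteq> 0"
        "1 - \<gamma>1 * q powi (k1 * (int (Suc m) - 1) + l1) \<noteq> 0"
    and "H_factor \<gamma>1 \<gamma>2 k1 l1 k2 l2 q (Suc m) \<noteq> 0"
proof -
  have r0: "0 \<le> r" using q norm_ge_zero order_trans by blast
  define t where "t = r ^ Suc m"
  have t: "t \<le> r" "t \<le> r ^ m" "t \<le> 1" "0 \<le> t"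
    using r r0 power_decreasing[of 1 "Suc m" r] power_decreasing[of m "Suc m" r]
      power_le_one[of r "Suc m"]
    by (simp_all add: t_def del: power_Suc)
  have ng: "norm \<gamma>1 = 1" "norm \<gamma>2 = 1" using g by auto
  define a where "a = - (q powi (k2 * int (Suc m)))"
  define b where "b = \<gamma>2 * q powi (k2 * int (Suc m) - l2)"
  define c where "c = \<gamma>2 * q powi (k2 * (int (Suc m) - 1) + l2)"
  define a' where "a' = - (q powi (k1 * int (Suc m)))"
  define b' where "b' = - (\<gamma>1 * q powi (k1 * int (Suc m) - l1))"
  define c' where "c' = - (\<gamma>1 * q powi (k1 * (int (Suc m) - 1) + l1))"
  note pb = powi_bound[OF q r]
  have n: "norm a \<le> t" "norm b \<le> t" "norm c \<le> t" "norm a' \<le> t" "norm b' \<le> t" "norm c' \<le> t"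
    unfolding a_def b_def c_def a'_def b'_def c'_def t_def norm_minus_cancel norm_mult ng mult_1
    by (intro pb exponent_bounds[OF kl1] exponent_bounds[OF kl2])+
  define N where "N = (1 + a) * (1 + b) * (1 + c)"
  define D where "D = (1 + a') * (1 + b') * (1 + c')"
  have F: "H_factor \<gamma>1 \<gamma>2 k1 l1 k2 l2 q (Suc m) = N / D"
    unfolding H_factor_def N_def D_def a_def b_def c_def a'_def b'_def c'_def by simp
  have ge: "1 - r \<le> norm (1 + a)" "1 - r \<le> norm (1 + b)" "1 - r \<le> norm (1 + c)"
     "1 - r \<le> norm (1 + a')" "1 - r \<le> norm (1 + b')" "1 - r \<le> norm (1 + c')"
    using n t by (intro norm_one_plus_ge; linarith)+
  then have nz: "1 + a \<noteq> 0" "1 + b \<noteq> 0" "1 + c \<noteq> 0" "1 + a' \<noteq> 0" "1 + b' \<noteq> 0" "1 + c' \<noteq> 0"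
    using r by auto
  have D: "(1 - r) ^ 3 \<le> norm D"
    unfolding D_def norm_mult power3_eq_cube using r ge by (intro mult_mono) auto
  have D0: "D \<noteq> 0" using nz by (simp add: D_def)
  have "norm (N - D) \<le> norm (N - 1) + norm (D - 1)"
    using norm_triangle_ineq4[of "N - 1" "D - 1"] by simp
  also have "\<dots> \<le> 7 * t + 7 * t"
    unfolding N_def D_def by (intro add_mono norm_prod3 n t)
  finally have ND: "norm (N - D) \<le> 14 * r ^ m" using t by simp
  have "N / D - 1 = (N - D) / D" using D0 by (simp add: diff_divide_distrib)
  then have "norm (N / D - 1) = norm (N - D) / norm D" by (simp add: norm_divide)
  also have "\<dots> \<le> (14 * r ^ m) / (1 - r) ^ 3"
    using ND D r r0 by (intro frac_le) auto
  finally show "norm (H_factor \<gamma>1 \<gamma>2 k1 l1 k2 l2 q (Suc m) - 1) \<le> 14 / (1 - r) ^ 3 * r ^ m"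
    unfolding F by simp
  show "H_factor \<gamma>1 \<gamma>2 k1 l1 k2 l2 q (Suc m) \<noteq> 0"
    unfolding F using D0 nz by (simp add: N_def)
  show "1 - q powi (k1 * int (Suc m)) \<noteq> 0" "1 - \<gamma>1 * q powi (k1 * int (Suc m) - l1) \<noteq> 0"
        "1 - \<gamma>1 * q powi (k1 * (int (Suc m) - 1) + l1) \<noteq> 0"
    using nz by (auto simp: a'_def b'_def c'_def)
qed

lemma holomorphic_powi_nonneg:
  assumes "0 \<le> e"
  shows "(\<lambda>q::complex. q powi e) holomorphic_on A"
  using assms by (auto simp: power_int_def intro!: holomorphic_intros)

lemma H_factor_holomorphic:
  "(\<lambda>q. H_factor \<gamma>1 \<gamma>2 k1 l1 k2 l2 q (Suc m)) holomorphic_on ball 0 1"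
proof -
  have e: "0 \<le> k * int (Suc m)" "0 \<le> k * int (Suc m) - l" "0 \<le> k * (int (Suc m) - 1) + l"
    if "0 < l" "l < k" for k l
    using exponent_bounds[OF that, of m] by linarith+
  have nz: "(1 - q powi (k1 * int (Suc m))) * (1 - \<gamma>1 * q powi (k1 * int (Suc m) - l1))
      * (1 - \<gamma>1 * q powi (k1 * (int (Suc m) - 1) + l1)) \<noteq> 0" if "q \<in> ball 0 1" for q
    using H_factor_bound(2-4)[of q "norm q" m] that
    unfolding mult_eq_0_iff mem_ball_0 by (metis order_refl)
  show ?thesis
    unfolding H_factor_def
    by (rule holomorphic_on_divide holomorphic_on_mult holomorphic_on_add holomorphic_on_diff
          holomorphic_on_const holomorphic_powi_nonneg e[OF kl1] e[OF kl2])+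
       (rule nz)
qed

lemma H_factor_uniform_limit:
  assumes r: "0 \<le> r" "r < 1"
  shows "uniform_limit (cball 0 r) (\<lambda>n q. \<Prod>m<n. H_factor \<gamma>1 \<gamma>2 k1 l1 k2 l2 q (Suc m))
           (H \<gamma>1 \<gamma>2 k1 l1 k2 l2) sequentially"
proof -
  let ?f = "\<lambda>m q. H_factor \<gamma>1 \<gamma>2 k1 l1 k2 l2 q (Suc m)"
  have sm: "summable (\<lambda>m. 14 / (1 - r) ^ 3 * r ^ m)"
    using r by (intro summable_mult summable_geometric) auto
  have "uniformly_convergent_on (cball 0 r) (\<lambda>n q. \<Prod>m<n. ?f m q)"
  proof (rule uniformly_convergent_on_prod')
    show "continuous_on (cball 0 r) (?f m)" for m
      by (rule continuous_on_subset[OF holomorphic_on_imp_continuous_on[OF H_factor_holomorphic]])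
         (use r in auto)
    show "uniformly_convergent_on (cball 0 r) (\<lambda>N q. \<Sum>m<N. norm (?f m q - 1))"
      by (rule Weierstrass_m_test'[OF _ sm]) (use H_factor_bound(1) r in auto)
  qed auto
  then have ul: "uniform_limit (cball 0 r) (\<lambda>n q. \<Prod>m<n. ?f m q) (\<lambda>q. lim (\<lambda>n. \<Prod>m<n. ?f m q)) sequentially"
    using uniformly_convergent_uniform_limit_iff by blast
  have "H \<gamma>1 \<gamma>2 k1 l1 k2 l2 q = lim (\<lambda>n. \<Prod>m<n. ?f m q)" if "q \<in> cball 0 r" for q
  proof -
    have "summable (\<lambda>m. norm (?f m q - 1))"
      by (rule summable_comparison_test'[OF sm, of 0]) (use H_factor_bound(1) r that in auto)
    then have "convergent_prod (\<lambda>m. ?f m q)"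
      by (rule abs_convergent_prod_imp_convergent_prod[OF summable_imp_abs_convergent_prod])
    moreover have "?f m q \<noteq> 0" for m
      by (rule H_factor_bound(5)[where r = r]) (use r that in auto)
    ultimately show ?thesis unfolding H_def by (rule prodinf_eq_lim')
  qed
  then show ?thesis
    by (rule iffD2[OF uniform_limit_cong'[OF refl] ul])
qed

lemma H_holomorphic: "H \<gamma>1 \<gamma>2 k1 l1 k2 l2 holomorphic_on ball 0 1"
proof (rule holomorphic_uniform_sequence)
  show "(\<lambda>q. \<Prod>m<n. H_factor \<gamma>1 \<gamma>2 k1 l1 k2 l2 q (Suc m)) holomorphic_on ball 0 1" for n
    by (intro holomorphic_on_prod H_factor_holomorphic)
  fix x :: complex assume x: "x \<in> ball 0 1"
  define d where "d = (1 - norm x) / 2"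
  have d: "0 < d" "norm x + d < 1" using x by (auto simp: d_def field_simps)
  have sub: "cball x d \<subseteq> cball 0 (norm x + d)"
  proof
    fix y assume "y \<in> cball x d"
    then show "y \<in> cball 0 (norm x + d)"
      using norm_triangle_sub[of y x] by (simp add: dist_norm norm_minus_commute)
  qed
  have "uniform_limit (cball x d) (\<lambda>n q. \<Prod>m<n. H_factor \<gamma>1 \<gamma>2 k1 l1 k2 l2 q (Suc m))
          (H \<gamma>1 \<gamma>2 k1 l1 k2 l2) sequentially"
    using H_factor_uniform_limit[of "norm x + d"] d
    by (intro uniform_limit_on_subset[OF _ sub]) auto
  moreover have "cball x d \<subseteq> ball 0 1" using sub d by auto
  ultimately show "\<exists>d>0. cball x d \<subseteq> ball 0 1 \<and>
      uniform_limit (cball x d) (\<lambda>n q. \<Prod>m<n. H_factor \<gamma>1 \<gamma>2 k1 l1 k2 l2 q (Suc m))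
        (H \<gamma>1 \<gamma>2 k1 l1 k2 l2) sequentially"
    using d by blast
qed auto

lemma sums_s:
  assumes "norm q < 1"
  shows "(\<lambda>n. s \<gamma>1 \<gamma>2 k1 l1 k2 l2 (int n) * q ^ n) sums H \<gamma>1 \<gamma>2 k1 l1 k2 l2 q"
  using holomorphic_power_series[OF H_holomorphic, of q] assms
  by (simp add: s_def fps_expansion_def)

end

lemma finite_M_le:
  assumes "0 < l" "l < k"
  shows "finite {j. M k l j \<le> n}"
proof (rule finite_subset)
  have "\<bar>j\<bar> \<le> \<bar>n\<bar>" if "M k l j \<le> n" for j
  proof -
    have e: "2 * M k l j = k * (j * (j - 1)) + 2 * l * j"
      unfolding M_def by simp
    have "0 \<le> j * (j - 1)" by (cases "j \<le> 0") (auto simp: mult_nonpos_nonpos)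
    show ?thesis
    proof (cases "j \<le> 0")
      case True
      have "(l + 1) * (j * (j - 1)) \<le> k * (j * (j - 1))"
        using assms \<open>0 \<le> j * (j - 1)\<close> by (intro mult_right_mono) auto
      moreover have j1: "0 \<le> j * (j + 1)"
        using True by (cases "j = 0") (auto simp: mult_nonpos_nonpos)
      moreover have "0 \<le> l * (j * (j + 1))" using assms j1 by simp
      moreover have "0 \<le> j * j" by simp
      ultimately have "- 2 * j \<le> 2 * M k l j" unfolding e by (simp add: algebra_simps)
      then show ?thesis using that True by linarith
    next
      case False
      have "0 \<le> k * (j * (j - 1))" using assms \<open>0 \<le> j * (j - 1)\<close> by simp
      moreover have "1 * j \<le> l * j" using assms False by (intro mult_right_mono) auto
      ultimately have "2 * j \<le> 2 * M k l j" unfolding e by simp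
      then show ?thesis using that False by linarith
    qed
  qed
  then show "{j. M k l j \<le> n} \<subseteq> {- \<bar>n\<bar>..\<bar>n\<bar>}" by fastforce
qed simp

(* The sum over nonzero integers in the recurrence is finite, hence infsum is the true value. *)
lemma finite_support_s:
  assumes "0 < l1" "l1 < k1"
  shows "finite {j. c j * s \<gamma>1 \<gamma>2 k1 l1 k2 l2 (n - M k1 l1 j) \<noteq> 0}"
  by (rule finite_subset[OF _ finite_M_le[OF assms, of n]]) (auto simp: s_def)

end

theory Submission
  imports Defs
begin

text \<open>
  Write \<open>\<Theta>\<^sub>1 = (\<Sum>j. (- \<gamma>1) powi j * q powi M k1 l1 j)\<close> and \<open>\<Theta>\<^sub>2 = (\<Sum>j. \<gamma>2 powi j * q powi M k2 l2 j)\<close>.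
  By the Jacobi triple product, applied with base \<open>q powi k\<close> at \<open>x = \<gamma> * q powi l\<close>, the numerator of \<open>H\<close>
  is \<open>\<Theta>\<^sub>2\<close> and the denominator is \<open>\<Theta>\<^sub>1\<close>. Hence \<open>H * \<Theta>\<^sub>1 = \<Theta>\<^sub>2\<close> for \<open>0 < norm q < 1\<close>
  (\<open>H_mult_theta\<close>), and comparing the coefficients of \<open>q ^ n\<close> gives
  \<open>(\<Sum>j. (- \<gamma>1) powi j * s (n - M k1 l1 j)) = [q ^ n] \<Theta>\<^sub>2\<close> (\<open>sum_s_shifted_eq_theta_coeff\<close>).
  Since \<open>M k2 l2\<close> is injective, the right-hand side is \<open>\<gamma>2 powi i\<close> if \<open>n = M k2 l2 i\<close>,
  and \<open>0\<close> if there is no such \<open>i\<close>. Isolating the summand \<open>j = 0\<close>, which is \<open>s n\<close>, yields the recurrence.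

  The triple product is the limit of a finite identity. The \<open>q\<close>-binomial theorem for \<open>2 * N\<close> factors,
  with the variable shifted by \<open>q powi - N\<close>, is that finite identity, and its coefficients are
  \<open>q\<close>-binomial coefficients (\<open>finite_triple_product\<close>). As \<open>N\<close> grows, these stay bounded and tend
  to \<open>1 / (\<Prod>i. 1 - q ^ Suc i)\<close>, so the limit may be taken termwise by dominated convergence.
\<close>

section \<open>Gaussian binomial coefficients\<close>

text \<open>The \<open>q\<close>-Pochhammer symbol \<open>(q; q)\<^sub>n = (1 - q) * (1 - q\<^sup>2) * \<dots> * (1 - q\<^sup>n)\<close>.\<close>

definition qfac :: "complex \<Rightarrow> nat \<Rightarrow> complex" where
  "qfac q n = (\<Prod>i<n. 1 - q ^ Suc i)"

text \<open>The Gaussian binomial coefficient, defined by the \<open>q\<close>-Pascal rule so that no division is needed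
  and no \<open>q\<close> has to be excluded.\<close>

fun qbin :: "complex \<Rightarrow> nat \<Rightarrow> nat \<Rightarrow> complex" where
  "qbin q n 0 = 1"
| "qbin q 0 (Suc k) = 0"
| "qbin q (Suc n) (Suc k) = qbin q n k + q ^ Suc k * qbin q n (Suc k)"

lemma qbin_eq_0: "n < k \<Longrightarrow> qbin q n k = 0"
  by (induction q n k rule: qbin.induct) auto

lemma qbin_qfac: "k \<le> n \<Longrightarrow> qbin q n k * (qfac q k * qfac q (n - k)) = qfac q n"
proof (induction q n k rule: qbin.induct)
  case (1 q n)
  show ?case by (simp add: qfac_def)
next
  case (2 q k)
  then show ?case by simp
next
  case (3 q n k)
  have a: "qbin q n k * (qfac q k * qfac q (n - k)) = qfac q n" using 3 by simp
  have S: "qfac q (Suc m) = (1 - q ^ Suc m) * qfac q m" for m by (simp add: qfac_def)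
  show ?case
  proof (cases "k = n")
    case True
    then show ?thesis using a by (simp add: qbin_eq_0 S)
  next
    case False
    then obtain d where d: "n = Suc k + d"
      using 3(3) by (metis Suc_leD Suc_le_mono le_neq_implies_less less_iff_Suc_add add_Suc)
    have b: "qbin q n (Suc k) * (qfac q (Suc k) * qfac q d) = qfac q n" using 3(2) d by simp
    have a': "qbin q n k * (qfac q k * qfac q (Suc d)) = qfac q n" using a d by simp
    have "qbin q (Suc n) (Suc k) * (qfac q (Suc k) * qfac q (Suc n - Suc k)) =
        (qbin q n k + q ^ Suc k * qbin q n (Suc k))
        * (((1 - q ^ Suc k) * qfac q k) * ((1 - q ^ Suc d) * qfac q d))"
      using d by (simp add: S del: power_Suc)
    also have "\<dots> =
       (1 - q ^ Suc k) * (qbin q n k * (qfac q k * ((1 - q ^ Suc d) * qfac q d)))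
       + q ^ Suc k * (1 - q ^ Suc d) * (qbin q n (Suc k) * (((1 - q ^ Suc k) * qfac q k) * qfac q d))"
      by (simp add: algebra_simps del: power_Suc)
    also have "\<dots> = (1 - q ^ Suc k) * qfac q n + q ^ Suc k * (1 - q ^ Suc d) * qfac q n"
      using a' b by (simp only: S)
    also have "\<dots> = (1 - q ^ Suc n) * qfac q n"
      unfolding d by (simp add: algebra_simps power_add)
    finally show ?thesis by (simp add: S)
  qed
qed

lemma choose_two_Suc: "Suc k choose 2 = k + (k choose 2)"
  by (simp add: numeral_2_eq_2)

lemma q_binomial_theorem:
  "(\<Prod>m<n. 1 + y * q ^ m) = (\<Sum>k\<le>n. qbin q n k * q ^ (k choose 2) * y ^ k)"
proof (induction n arbitrary: y)
  case 0
  show ?case by (simp add: numeral_2_eq_2)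
next
  case (Suc n)
  define t where "t k = q ^ (Suc k choose 2) * y ^ k" for k
  have "(\<Prod>m<Suc n. 1 + y * q ^ m) = (1 + y) * (\<Prod>m<n. 1 + (y * q) * q ^ m)"
    unfolding prod.lessThan_Suc_shift by (simp add: mult_ac)
  also have "(\<Prod>m<n. 1 + (y * q) * q ^ m) = (\<Sum>k\<le>n. qbin q n k * t k)"
    unfolding Suc.IH t_def by (intro sum.cong) (simp_all add: choose_two_Suc power_add power_mult_distrib mult_ac)
  also have "(1 + y) * \<dots> = (\<Sum>k\<le>Suc n. qbin q n k * t k) + (\<Sum>k\<le>n. qbin q n k * t k * y)"
    by (simp add: qbin_eq_0 ring_distribs sum_distrib_left sum.distrib mult_ac)
  also have "\<dots> = 1 + (\<Sum>k\<le>n. qbin q n (Suc k) * t (Suc k) + qbin q n k * t k * y)"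
    unfolding sum.atMost_Suc_shift sum.distrib by (simp add: t_def choose_two_Suc numeral_2_eq_2)
  also have "(\<Sum>k\<le>n. qbin q n (Suc k) * t (Suc k) + qbin q n k * t k * y)
      = (\<Sum>k\<le>n. qbin q (Suc n) (Suc k) * q ^ (Suc k choose 2) * y ^ Suc k)"
    unfolding t_def choose_two_Suc[of "Suc k" for k] power_add
    by (intro sum.cong) (simp_all add: algebra_simps)
  also have "1 + \<dots> = (\<Sum>k\<le>Suc n. qbin q (Suc n) k * q ^ (k choose 2) * y ^ k)"
    by (simp only: sum.atMost_Suc_shift) (simp add: binomial_eq_0)
  finally show ?case .
qed

lemma two_times_choose_two: "2 * int (k choose 2) = int k * (int k - 1)"
  by (induction k) (simp_all add: choose_two_Suc algebra_simps numeral_2_eq_2)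

lemma prod_lessThan_add:
  fixes g :: "nat \<Rightarrow> 'a::comm_monoid_mult"
  shows "(\<Prod>m<L + N. g m) = (\<Prod>m<L. g m) * (\<Prod>m<N. g (L + m))"
  by (induction N) (simp_all add: mult_ac)

text \<open>The finite form of the triple product: the \<open>q\<close>-binomial theorem for \<open>\<Prod>m<2 * N. 1 + y * q ^ m\<close> at
  \<open>y = x / q ^ N\<close>. There the factors with \<open>m < N\<close> become, up to the constant \<open>x / q ^ Suc i\<close> each, the
  factors \<open>1 + q ^ Suc i / x\<close> with \<open>i < N\<close>, and those with \<open>m \<ge> N\<close> are the factors \<open>1 + x * q ^ i\<close>.\<close>

lemma finite_triple_product:
  fixes q x :: complex
  assumes q: "q \<noteq> 0" and x: "x \<noteq> 0"
  shows "(\<Prod>m<N. (1 + x * q ^ m) * (1 + q ^ Suc m / x)) =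
    (\<Sum>j = - int N..int N. qbin q (2 * N) (nat (int N + j)) * (q powi (j * (j - 1) div 2) * x powi j))"
proof -
  \<comment> \<open>The constant extracted from the lower half of the product.\<close>
  define c where "c = (\<Prod>m<N. x / q ^ Suc m)"
  have c: "c = x ^ N / q ^ (Suc N choose 2)"
    unfolding c_def by (induction N) (simp_all add: choose_two_Suc power_add numeral_2_eq_2 mult_ac)
  have c0: "c \<noteq> 0" using q x by (simp add: c)
  have "(\<Prod>m<N. 1 + x / q ^ N * q ^ m) = (\<Prod>m<N. 1 + x / q ^ N * q ^ (N - Suc m))"
    by (rule prod.nat_diff_reindex[symmetric])
  also have "\<dots> = (\<Prod>m<N. (x / q ^ Suc m) * (1 + q ^ Suc m / x))"
  proof (rule prod.cong[OF refl])
    fix m assume "m \<in> {..<N}"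
    then have "q ^ N = q ^ (N - Suc m) * q ^ Suc m"
      by (subst power_add[symmetric]) simp
    then show "1 + x / q ^ N * q ^ (N - Suc m) = (x / q ^ Suc m) * (1 + q ^ Suc m / x)"
      using q x by (simp add: field_simps)
  qed
  also have "\<dots> = c * (\<Prod>m<N. 1 + q ^ Suc m / x)"
    unfolding c_def by (rule prod.distrib)
  finally have low: "(\<Prod>m<N. 1 + x / q ^ N * q ^ m) = c * (\<Prod>m<N. 1 + q ^ Suc m / x)" .
  have "(\<Prod>m<2 * N. 1 + x / q ^ N * q ^ m) =
      (\<Prod>m<N. 1 + x / q ^ N * q ^ m) * (\<Prod>m<N. 1 + x / q ^ N * q ^ (N + m))"
    unfolding mult_2 by (rule prod_lessThan_add)
  also have "\<dots> = c * (\<Prod>m<N. (1 + x * q ^ m) * (1 + q ^ Suc m / x))"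
    unfolding low using q by (simp add: prod.distrib power_add mult_ac)
  finally have "(\<Prod>m<N. (1 + x * q ^ m) * (1 + q ^ Suc m / x)) = (\<Prod>m<2 * N. 1 + x / q ^ N * q ^ m) / c"
    using c0 by simp
  also have "\<dots> = (\<Sum>k\<le>2 * N. qbin q (2 * N) k * (q ^ (k choose 2) * (x / q ^ N) ^ k / c))"
    unfolding q_binomial_theorem by (simp add: sum_divide_distrib mult_ac)
  also have "\<dots> = (\<Sum>j = - int N..int N. qbin q (2 * N) (nat (int N + j)) * (q powi (j * (j - 1) div 2) * x powi j))"
  proof (rule sum.reindex_bij_witness[where i = "\<lambda>j. nat (int N + j)" and j = "\<lambda>k. int k - int N"])
    fix k assume "k \<in> {..2 * N}"
    define j where "j = int k - int N"
    have e2: "2 * (int (k choose 2) + int (Suc N choose 2) - int N * int k) = j * (j - 1)"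
      unfolding ring_distribs right_diff_distrib two_times_choose_two j_def by (simp add: algebra_simps)
    then have e: "j * (j - 1) div 2 = int (k choose 2) + int (Suc N choose 2) - int N * int k"
      by (simp flip: e2)
    have "q powi (j * (j - 1) div 2) * x powi j
        = q ^ (k choose 2) * q ^ (Suc N choose 2) / (q ^ N) ^ k * (x ^ k / x ^ N)"
      unfolding e unfolding j_def using q x
      by (simp add: power_int_diff power_int_add flip: power_mult of_nat_mult)
    also have "\<dots> = q ^ (k choose 2) * (x / q ^ N) ^ k / c"
      using q x by (simp add: c power_divide field_simps)
    finally show "qbin q (2 * N) (nat (int N + (int k - int N)))
        * (q powi ((int k - int N) * (int k - int N - 1) div 2) * x powi (int k - int N)) =
      qbin q (2 * N) k * (q ^ (k choose 2) * (x / q ^ N) ^ k / c)"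
      by (simp add: j_def)
  qed auto
  finally show ?thesis .
qed

section \<open>The Jacobi triple product\<close>

text \<open>Sums over the integers are turned into series along the bijection \<open>int_decode\<close>, so that Tannery's
  theorem for series gives dominated convergence over the integers.\<close>

lemma infsum_int_eq_suminf:
  fixes g :: "int \<Rightarrow> complex"
  assumes "(\<lambda>j. norm (g j)) summable_on UNIV"
  shows "infsum g UNIV = (\<Sum>k. g (int_decode k))"
proof -
  have "(\<lambda>k. norm (g (int_decode k))) summable_on UNIV"
    using summable_on_reindex_bij_betw[OF bij_int_decode, of "\<lambda>j. norm (g j)"] assms by simp
  then have "(\<lambda>k. g (int_decode k)) summable_on UNIV" by (rule abs_summable_summable)
  then have "(\<lambda>k. g (int_decode k)) sums (\<Sum>\<^sub>\<infinity>k. g (int_decode k))"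
    by (intro has_sum_imp_sums has_sum_infsum)
  then show ?thesis
    using infsum_reindex_bij_betw[OF bij_int_decode, of g] by (simp add: sums_iff)
qed

lemma tendsto_infsum_int_dominated:
  fixes f :: "nat \<Rightarrow> int \<Rightarrow> complex"
  assumes lim: "\<And>j. (\<lambda>N. f N j) \<longlonglongrightarrow> g j"
    and bound: "\<And>N j. norm (f N j) \<le> h j" and h: "h summable_on UNIV"
  shows "(\<lambda>N. infsum (f N) UNIV) \<longlonglongrightarrow> infsum g UNIV"
proof -
  have f: "(\<lambda>j. norm (f N j)) summable_on UNIV" for N
    by (rule Infinite_Sum.abs_summable_on_comparison_test'[OF h]) (use bound in auto)
  have g_le: "norm (g j) \<le> h j" for j
    by (rule tendsto_upperbound[OF tendsto_norm[OF lim]]) (use bound in auto)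
  have g: "(\<lambda>j. norm (g j)) summable_on UNIV"
    by (rule Infinite_Sum.abs_summable_on_comparison_test'[OF h]) (use g_le in auto)
  have "h \<circ> int_decode summable_on UNIV"
    using summable_on_reindex_bij_betw[OF bij_int_decode, of h] h by (simp add: o_def)
  then have "summable (h \<circ> int_decode)"
    by (rule summable_on_imp_summable)
  then have "(\<lambda>N. \<Sum>k. f N (int_decode k)) \<longlonglongrightarrow> (\<Sum>k. g (int_decode k))"
    using tannerys_theorem[of "\<lambda>k N. f N (int_decode k)" "\<lambda>k. g (int_decode k)" sequentially "h \<circ> int_decode"]
    by (simp add: lim bound case_prod_unfold)
  then show ?thesis by (simp add: infsum_int_eq_suminf f g)
qed

lemma one_minus_power_nonzero:
  fixes q :: complex
  assumes "norm q < 1"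
  shows "1 - q ^ Suc i \<noteq> 0"
proof
  assume "1 - q ^ Suc i = 0"
  then have "norm q ^ Suc i = 1" by (metis eq_iff_diff_eq_0 norm_one norm_power)
  then show False using power_Suc_less_one[of "norm q" i] assms by (cases "q = 0") auto
qed

text \<open>The limit is nonzero, so both \<open>qfac q\<close> and its inverse are bounded sequences.\<close>

lemma qfac_tendsto:
  assumes q: "norm q < 1"
  obtains L where "qfac q \<longlonglongrightarrow> L" "L \<noteq> 0"
proof -
  have nz: "1 - q ^ Suc i \<noteq> 0" for i
    by (rule one_minus_power_nonzero[OF q])
  have "summable (\<lambda>i. norm (1 - q ^ Suc i - 1))"
    using q by (simp add: norm_power norm_mult summable_mult)
  then have "convergent_prod (\<lambda>i. 1 - q ^ Suc i)"
    by (intro abs_convergent_prod_imp_convergent_prod summable_imp_abs_convergent_prod)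
  then have "(\<lambda>n. \<Prod>i\<le>n. 1 - q ^ Suc i) \<longlonglongrightarrow> (\<Prod>i. 1 - q ^ Suc i)"
    "(\<Prod>i. 1 - q ^ Suc i) \<noteq> 0"
    using convergent_prod_LIMSEQ prodinf_nonzero nz by blast+
  then show thesis
    by (intro that[of "\<Prod>i. 1 - q ^ Suc i"])
       (auto simp: qfac_def[abs_def] LIMSEQ_lessThan_iff_atMost)
qed

lemma qfac_nonzero: "norm q < 1 \<Longrightarrow> qfac q n \<noteq> 0"
  unfolding qfac_def using one_minus_power_nonzero by (simp del: power_Suc)

lemma summable_power_choose_two:
  fixes r c :: real
  assumes "0 \<le> r" "r < 1"
  shows "summable (\<lambda>n. r ^ (n choose 2) * c ^ n)"
proof -
  have "(\<lambda>n. r ^ n * \<bar>c\<bar>) \<longlonglongrightarrow> 0"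
    using assms by (intro tendsto_mult_left_zero LIMSEQ_realpow_zero)
  then have "eventually (\<lambda>n. r ^ n * \<bar>c\<bar> < 1 / 2) sequentially"
    by (rule order_tendstoD) simp
  then obtain N where N: "\<And>n. n \<ge> N \<Longrightarrow> r ^ n * \<bar>c\<bar> < 1 / 2"
    by (auto simp: eventually_sequentially)
  show ?thesis
  proof (rule summable_ratio_test[of "1 / 2" N])
    fix n assume "N \<le> n"
    have "norm (r ^ (Suc n choose 2) * c ^ Suc n) = (r ^ n * \<bar>c\<bar>) * norm (r ^ (n choose 2) * c ^ n)"
      by (simp add: choose_two_Suc power_add abs_mult power_abs assms mult_ac)
    also have "\<dots> \<le> 1 / 2 * norm (r ^ (n choose 2) * c ^ n)"
      by (intro mult_right_mono) (use N[OF \<open>N \<le> n\<close>] in auto)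
    finally show "norm (r ^ (Suc n choose 2) * c ^ Suc n) \<le> 1 / 2 * norm (r ^ (n choose 2) * c ^ n)" .
  qed simp
qed

lemma abs_summable_theta:
  fixes q x :: complex
  assumes q: "q \<noteq> 0" "norm q < 1" and x: "x \<noteq> 0"
  shows "(\<lambda>j. norm (q powi (j * (j - 1) div 2) * x powi j)) summable_on UNIV"
proof -
  define t where "t j = norm (q powi (j * (j - 1) div 2) * x powi j)" for j
  have e: "int n * (int n - 1) div 2 = int (n choose 2)" for n
    by (simp flip: two_times_choose_two)
  have pos: "t (int n) = norm q ^ (n choose 2) * norm x ^ n" for n
    unfolding t_def e by (simp add: norm_mult norm_power)
  have "(- int n) * (- int n - 1) div 2 = int (Suc n choose 2)" for n
    using e[of "Suc n"] by (simp add: algebra_simps)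
  \<comment> \<open>So the terms with negative index form a series of the same kind, with \<open>q / x\<close> in place of \<open>x\<close>.\<close>
  note e' = this[unfolded choose_two_Suc]
  have neg: "t (- int n) = norm q ^ (n choose 2) * (norm q / norm x) ^ n" for n
    unfolding t_def e' power_int_of_nat power_int_minus
    by (simp add: norm_mult norm_power norm_inverse norm_divide power_add power_divide field_simps del: of_nat_add)
  have s: "(\<lambda>n. norm q ^ (n choose 2) * c ^ n) summable_on UNIV" if "c \<ge> 0" for c
    using summable_power_choose_two[of "norm q" c] q that by (simp add: summable_on_UNIV_nonneg_real_iff)
  have "t summable_on range int"
    using s[of "norm x"] by (subst summable_on_reindex) (auto simp: o_def pos)
  moreover have "t summable_on range (\<lambda>n. - int n)"
    using s[of "norm q / norm x"] by (subst summable_on_reindex) (auto simp: o_def neg inj_on_def)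
  ultimately have "t summable_on (range int \<union> range (\<lambda>n. - int n))"
    by (rule summable_on_union)
  also have "range int \<union> range (\<lambda>n. - int n) = UNIV"
    by (auto simp: image_iff) (metis int_cases2)
  finally show ?thesis by (simp add: t_def[abs_def])
qed

theorem jacobi_triple_product:
  fixes q x :: complex
  assumes q: "q \<noteq> 0" "norm q < 1" and x: "x \<noteq> 0"
  shows "(\<lambda>N. \<Prod>m<N. (1 - q ^ Suc m) * (1 + x * q ^ m) * (1 + q ^ Suc m / x))
           \<longlonglongrightarrow> (\<Sum>\<^sub>\<infinity>j. q powi (j * (j - 1) div 2) * x powi j)"
proof -
  define t where "t j = q powi (j * (j - 1) div 2) * x powi j" for j
  \<comment> \<open>The coefficients of the finite identity, extended by zero to all integers.\<close>
  define c where "c N j = (if j \<in> {- int N..int N} then qbin q (2 * N) (nat (int N + j)) else 0)" for N j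
  obtain L where L: "qfac q \<longlonglongrightarrow> L" "L \<noteq> 0" using qfac_tendsto[OF q(2)] .
  note nz = qfac_nonzero[OF q(2)]
  obtain B where B: "\<And>n. norm (qfac q n) \<le> B"
    using convergent_imp_Bseq[of "qfac q"] L(1) by (auto simp: convergent_def Bseq_def)
  obtain C where C: "\<And>n. norm (inverse (qfac q n)) \<le> C"
    using convergent_imp_Bseq[of "\<lambda>n. inverse (qfac q n)"] tendsto_inverse[OF L]
    by (auto simp: convergent_def Bseq_def)
  have ceq: "c N j = qfac q (2 * N) * inverse (qfac q (nat (int N + j))) * inverse (qfac q (nat (int N - j)))"
    if "j \<in> {- int N..int N}" for N j
  proof -
    have "2 * N - nat (int N + j) = nat (int N - j)" using that by auto
    then show ?thesis
      using qbin_qfac[of "nat (int N + j)" "2 * N" q] that nz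
      by (auto simp: c_def field_simps nat_le_iff)
  qed
  have B0: "0 \<le> B" "0 \<le> C" using B[of 0] C[of 0] norm_ge_zero order_trans by blast+
  have cbound: "norm (c N j) \<le> B * C * C" for N j
  proof (cases "j \<in> {- int N..int N}")
    case True
    show ?thesis unfolding ceq[OF True] norm_mult
      by (intro mult_mono B C mult_nonneg_nonneg B0 norm_ge_zero)
  next
    case False
    then show ?thesis using B0 by (auto simp: c_def)
  qed
  have sub: "filterlim (\<lambda>N. nat (int N + j)) at_top sequentially" for j
    unfolding filterlim_at_top
  proof
    fix Z
    show "\<forall>\<^sub>F N in sequentially. Z \<le> nat (int N + j)"
      by (rule eventually_sequentiallyI[of "Z + nat \<bar>j\<bar>"]) linarith
  qed
  have clim: "(\<lambda>N. c N j) \<longlonglongrightarrow> inverse L" for j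
  proof -
    have 2: "filterlim (\<lambda>N::nat. 2 * N) at_top sequentially"
      by (rule filterlim_subseq) (simp add: strict_mono_def)
    have "(\<lambda>N. qfac q (2 * N) * inverse (qfac q (nat (int N + j))) * inverse (qfac q (nat (int N + - j))))
       \<longlonglongrightarrow> L * inverse L * inverse L"
      by (intro tendsto_mult tendsto_inverse L filterlim_compose[OF L(1)] 2 sub)
    moreover have "\<forall>\<^sub>F N in sequentially. qfac q (2 * N) * inverse (qfac q (nat (int N + j))) * inverse (qfac q (nat (int N + - j))) = c N j"
      by (rule eventually_sequentiallyI[of "nat \<bar>j\<bar>"]) (subst ceq, auto)
    ultimately show ?thesis using L(2) by (simp add: tendsto_cong)
  qed
  have h: "(\<lambda>j. B * C * C * norm (t j)) summable_on UNIV"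
    unfolding t_def by (intro summable_on_cmult_right abs_summable_theta assms)
  have "(\<lambda>N. infsum (\<lambda>j. c N j * t j) UNIV) \<longlonglongrightarrow> infsum (\<lambda>j. inverse L * t j) UNIV"
    by (rule tendsto_infsum_int_dominated[OF _ _ h])
       (auto intro!: tendsto_mult clim mult_right_mono cbound simp: norm_mult)
  moreover have "infsum (\<lambda>j. c N j * t j) UNIV = (\<Prod>m<N. (1 + x * q ^ m) * (1 + q ^ Suc m / x))" for N
  proof -
    have "infsum (\<lambda>j. c N j * t j) UNIV = infsum (\<lambda>j. c N j * t j) {- int N..int N}"
      by (rule infsum_cong_neutral) (auto simp: c_def)
    then show ?thesis
      unfolding finite_triple_product[OF q(1) x] by (simp add: c_def t_def)
  qed
  ultimately have "(\<lambda>N. qfac q N * (\<Prod>m<N. (1 + x * q ^ m) * (1 + q ^ Suc m / x)))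
      \<longlonglongrightarrow> L * infsum (\<lambda>j. inverse L * t j) UNIV"
    by (intro tendsto_mult L) simp
  also have "L * infsum (\<lambda>j. inverse L * t j) UNIV = infsum t UNIV"
    using L(2) by (simp add: infsum_cmult_right')
  finally show ?thesis
    by (simp add: t_def[abs_def] qfac_def prod.distrib mult_ac)
qed

section \<open>Theta series\<close>

text \<open>If \<open>M k l i = M k l j\<close> with \<open>i \<noteq> j\<close>, then \<open>2 * l = k * (1 - i - j)\<close>; but \<open>0 < 2 * l < 2 * k\<close>
  leaves only \<open>2 * l = k\<close>, the excluded boundary case.\<close>

lemma M_inj:
  assumes "0 < l" "l < k" "2 * l \<noteq> k"
  shows "inj (M k l)"
proof (rule injI, rule ccontr)
  fix i j assume eq: "M k l i = M k l j" and "i \<noteq> j"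
  have M2: "2 * M k l j = k * (j * (j - 1)) + 2 * l * j" for j
    unfolding M_def by simp
  have "(i - j) * (k * (i + j - 1) + 2 * l) = 2 * M k l i - 2 * M k l j"
    unfolding M2 by (simp add: algebra_simps)
  then have "k * (i + j - 1) + 2 * l = 0" using eq \<open>i \<noteq> j\<close> by (metis diff_self eq_iff_diff_eq_0 mult_eq_0_iff)
  then have "2 * l = k * (1 - i - j)" by (simp add: algebra_simps)
  moreover have "0 < 2 * l" "2 * l < k * 2" using assms by auto
  ultimately have "0 < k * (1 - i - j)" "k * (1 - i - j) < k * 2" by simp_all
  then have "1 - i - j = 1" using assms by (simp add: zero_less_mult_iff)
  then show False using \<open>2 * l = _\<close> assms by simp
qed

lemma M_nonneg:
  assumes "0 < l" "l < k"
  shows "0 \<le> M k l j"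
proof -
  have "2 * M k l j = (k - l) * (j * (j - 1)) + l * (j * (j + 1))"
    unfolding M_def by (simp add: algebra_simps)
  moreover have "0 \<le> (k - l) * (j * (j - 1))" "0 \<le> l * (j * (j + 1))"
    using assms by (auto simp: zero_le_mult_iff)
  ultimately show ?thesis by linarith
qed

text \<open>The triple product with base \<open>Q = q powi k\<close> at \<open>x = \<gamma> * q powi l\<close>. The condition on \<open>\<gamma>\<close> makes it its
  own inverse, which turns \<open>Q ^ Suc m / x\<close> into \<open>\<gamma> * q powi (k * int (Suc m) - l)\<close>.\<close>

lemma theta_product:
  fixes q \<gamma> :: complex
  assumes q: "q \<noteq> 0" "norm q < 1" and \<gamma>: "\<gamma> \<in> {1, - 1}" and kl: "0 < l" "l < k"
  shows "(\<lambda>N. \<Prod>m<N. (1 - q powi (k * int (Suc m))) * (1 + \<gamma> * q powi (k * int (Suc m) - l))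
              * (1 + \<gamma> * q powi (k * (int (Suc m) - 1) + l)))
           \<longlonglongrightarrow> (\<Sum>\<^sub>\<infinity>j. \<gamma> powi j * q powi M k l j)" (is ?lim)
    and "(\<lambda>j. \<gamma> powi j * q powi M k l j) summable_on UNIV" (is ?summable)
proof -
  define Q where "Q = q powi k"
  define x where "x = \<gamma> * q powi l"
  have \<gamma>0: "\<gamma> \<noteq> 0" using \<gamma> by auto
  have nQ: "norm Q < 1"
    using power_Suc_less_one[of "norm q" "nat k - 1"] q kl
    by (simp add: Q_def power_int_def norm_power flip: power_Suc)
  have Q0: "Q \<noteq> 0" and x0: "x \<noteq> 0" using q \<gamma>0 by (auto simp: Q_def x_def)
  have Qp: "Q ^ n = q powi (k * int n)" for n
    by (simp add: Q_def power_int_mult)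
  have "(1 - Q ^ Suc m) * (1 + x * Q ^ m) * (1 + Q ^ Suc m / x) =
     (1 - q powi (k * int (Suc m))) * (1 + \<gamma> * q powi (k * int (Suc m) - l))
              * (1 + \<gamma> * q powi (k * (int (Suc m) - 1) + l))" for m
  proof -
    have "Q ^ Suc m / x = \<gamma> * q powi (k * int (Suc m) - l)"
      unfolding Qp x_def using q \<gamma> by (auto simp: power_int_diff)
    moreover have "x * Q ^ m = \<gamma> * q powi (k * (int (Suc m) - 1) + l)"
      unfolding Qp x_def using q by (simp add: power_int_add)
    ultimately show ?thesis by (simp only: Qp mult_ac)
  qed
  moreover have "Q powi (j * (j - 1) div 2) * x powi j = \<gamma> powi j * q powi M k l j" for j
  proof -
    have "M k l j = k * (j * (j - 1) div 2) + l * j"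
      unfolding M_def by (simp add: div_mult_swap)
    then show ?thesis
      using q by (simp add: Q_def x_def power_int_add power_int_mult power_int_mult_distrib)
  qed
  ultimately show ?lim ?summable
    using jacobi_triple_product[OF Q0 nQ x0] abs_summable_summable[OF abs_summable_theta[OF Q0 nQ x0]] by simp_all
qed

text \<open>The triple product excludes \<open>q = 0\<close>; by continuity this does not affect power series expansions.\<close>

lemma fps_expansion_unique_punctured:
  fixes f g :: "complex \<Rightarrow> complex"
  assumes f: "f has_fps_expansion F" and g: "g has_fps_expansion G"
    and eq: "\<forall>\<^sub>F z in at 0. f z = g z"
  shows "F = G"
proof -
  have lim: "f \<midarrow>0\<rightarrow> f 0" "g \<midarrow>0\<rightarrow> g 0"
    using has_fps_expansion_imp_continuous[OF f, of UNIV] has_fps_expansion_imp_continuous[OF g, of UNIV]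
    by (auto simp: isCont_def)
  have "f \<midarrow>0\<rightarrow> g 0"
    using lim(2) tendsto_cong[OF eq] by blast
  then have "f 0 = g 0" using lim(1) LIM_unique by blast
  then have "\<forall>\<^sub>F z in nhds 0. f z = g z"
    using eq eventually_nhds_conv_at by blast
  then have "f has_fps_expansion G"
    using g has_fps_expansion_cong[of f g G G] by blast
  then show ?thesis using f fps_expansion_unique_complex by blast
qed

text \<open>The coefficient of \<open>q ^ n\<close> in \<open>\<Sum>j. \<gamma> powi j * q powi M k l j\<close>. For \<open>0 < l < k\<close> only finitely
  many \<open>j\<close> satisfy \<open>M k l j = n\<close>, so the sum does not take the
  value \<open>0\<close> that is the default for infinite index sets.\<close>

definition theta_coeff :: "int \<Rightarrow> int \<Rightarrow> complex \<Rightarrow> nat \<Rightarrow> complex" where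
  "theta_coeff k l \<gamma> n = (\<Sum>j | M k l j = int n. \<gamma> powi j)"

lemma theta_coeff_M:
  assumes "0 < l" "l < k" "2 * l \<noteq> k"
  shows "theta_coeff k l \<gamma> (nat (M k l i)) = \<gamma> powi i"
proof -
  have "{j. M k l j = int (nat (M k l i))} = {i}"
    using M_inj[OF assms] M_nonneg[OF assms(1,2)] by (auto simp: inj_def)
  then show ?thesis by (simp add: theta_coeff_def)
qed

lemma theta_sums:
  assumes kl: "0 < l" "l < k" "2 * l \<noteq> k"
    and summable: "(\<lambda>j. \<gamma> powi j * q powi M k l j) summable_on UNIV"
  shows "(\<lambda>n. theta_coeff k l \<gamma> n * q ^ n) sums (\<Sum>\<^sub>\<infinity>j. \<gamma> powi j * q powi M k l j)"
proof -
  define m where "m j = nat (M k l j)" for j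
  have inj: "inj m"
    using M_inj[OF kl] M_nonneg[OF kl(1,2)] by (auto simp: inj_def m_def eq_nat_nat_iff)
  have "theta_coeff k l \<gamma> (m j) * q ^ m j = \<gamma> powi j * q powi M k l j" for j
    unfolding m_def theta_coeff_M[OF kl] using M_nonneg[OF kl(1,2), of j] by (simp add: power_int_def)
  then have "((\<lambda>n. theta_coeff k l \<gamma> n * q ^ n) has_sum (\<Sum>\<^sub>\<infinity>j. \<gamma> powi j * q powi M k l j)) (range m)"
    using has_sum_infsum[OF summable] by (subst has_sum_reindex[OF inj]) (simp add: o_def)
  moreover have "theta_coeff k l \<gamma> n = 0" if "n \<notin> range m" for n
  proof -
    have "{j. M k l j = int n} = {}" using that by (auto simp: m_def) (metis nat_int rangeI)
    then show ?thesis by (simp add: theta_coeff_def)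
  qed
  ultimately have "((\<lambda>n. theta_coeff k l \<gamma> n * q ^ n) has_sum (\<Sum>\<^sub>\<infinity>j. \<gamma> powi j * q powi M k l j)) UNIV"
    by (subst has_sum_cong_neutral[where T = "range m"]) auto
  then show ?thesis by (rule has_sum_imp_sums)
qed

section \<open>The recurrence\<close>

context
  fixes \<gamma>1 \<gamma>2 :: complex and k1 l1 k2 l2 :: int
  assumes g: "\<gamma>1 \<in> {1, - 1}" "\<gamma>2 \<in> {1, - 1}"
    and kl1: "0 < l1" "l1 < k1" "2 * l1 \<noteq> k1" and kl2: "0 < l2" "l2 < k2" "2 * l2 \<noteq> k2"
begin

lemma H_mult_theta:
  assumes q: "q \<noteq> 0" "norm q < 1"
  shows "H \<gamma>1 \<gamma>2 k1 l1 k2 l2 q * (\<Sum>\<^sub>\<infinity>j. (- \<gamma>1) powi j * q powi M k1 l1 j)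
    = (\<Sum>\<^sub>\<infinity>j. \<gamma>2 powi j * q powi M k2 l2 j)"
proof -
  let ?F = "H_factor \<gamma>1 \<gamma>2 k1 l1 k2 l2 q"
  define D where "D m = (1 - q powi (k1 * int (Suc m))) * (1 + (- \<gamma>1) * q powi (k1 * int (Suc m) - l1))
        * (1 + (- \<gamma>1) * q powi (k1 * (int (Suc m) - 1) + l1))" for m
  define E where "E m = (1 - q powi (k2 * int (Suc m))) * (1 + \<gamma>2 * q powi (k2 * int (Suc m) - l2))
        * (1 + \<gamma>2 * q powi (k2 * (int (Suc m) - 1) + l2))" for m
  note g' = g kl1(1,2) kl2(1,2)
  have FD: "?F (Suc m) * D m = E m" for m
  proof -
    have "D m \<noteq> 0" using H_factor_bound(2-4)[OF g' order_refl q(2), of m] by (simp add: D_def)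
    moreover have "?F (Suc m) = E m / D m" by (simp add: H_factor_def D_def E_def)
    ultimately show ?thesis by simp
  qed
  have "(\<lambda>N. \<Prod>m<N. ?F (Suc m)) \<longlonglongrightarrow> H \<gamma>1 \<gamma>2 k1 l1 k2 l2 q"
    by (rule tendsto_uniform_limitI[OF H_factor_uniform_limit[OF g', of "norm q"]]) (use q in auto)
  moreover have "(\<lambda>N. \<Prod>m<N. D m) \<longlonglongrightarrow> (\<Sum>\<^sub>\<infinity>j. (- \<gamma>1) powi j * q powi M k1 l1 j)"
    unfolding D_def by (rule theta_product[OF q _ kl1(1,2)]) (use g in auto)
  ultimately have "(\<lambda>N. (\<Prod>m<N. ?F (Suc m)) * (\<Prod>m<N. D m)) \<longlonglongrightarrow>
      H \<gamma>1 \<gamma>2 k1 l1 k2 l2 q * (\<Sum>\<^sub>\<infinity>j. (- \<gamma>1) powi j * q powi M k1 l1 j)"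
    by (rule tendsto_mult)
  moreover have "(\<lambda>N. (\<Prod>m<N. ?F (Suc m)) * (\<Prod>m<N. D m)) \<longlonglongrightarrow> (\<Sum>\<^sub>\<infinity>j. \<gamma>2 powi j * q powi M k2 l2 j)"
    unfolding prod.distrib[symmetric] FD E_def by (rule theta_product[OF q g(2) kl2(1,2)])
  ultimately show ?thesis by (rule LIMSEQ_unique)
qed

lemma fps_s_mult_theta:
  "Abs_fps (\<lambda>n. s \<gamma>1 \<gamma>2 k1 l1 k2 l2 (int n)) * Abs_fps (theta_coeff k1 l1 (- \<gamma>1))
    = Abs_fps (theta_coeff k2 l2 \<gamma>2)" (is "?S * ?A = ?B")
proof -
  \<comment> \<open>The triple product gives the sum over the integers for \<open>q \<noteq> 0\<close> only. Its power series also defines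
    it at \<open>q = 0\<close>.\<close>
  define \<theta> where "\<theta> k l \<gamma> q = (\<Sum>n. theta_coeff k l \<gamma> n * q ^ n)" for k l \<gamma> and q :: complex
  have \<theta>: "(\<lambda>n. theta_coeff k l \<gamma> n * q ^ n) sums \<theta> k l \<gamma> q"
    "q \<noteq> 0 \<Longrightarrow> \<theta> k l \<gamma> q = (\<Sum>\<^sub>\<infinity>j. \<gamma> powi j * q powi M k l j)"
    if "0 < l" "l < k" "2 * l \<noteq> k" "\<gamma> \<in> {1, - 1}" "norm q < 1" for k l \<gamma> q
  proof -
    have *: "(\<lambda>n. theta_coeff k l \<gamma> n * q ^ n) sums (\<Sum>\<^sub>\<infinity>j. \<gamma> powi j * q powi M k l j)" if "q \<noteq> 0"
      by (intro theta_sums theta_product(2) that \<open>0 < l\<close> \<open>l < k\<close> \<open>2 * l \<noteq> k\<close> \<open>\<gamma> \<in> {1, - 1}\<close> \<open>norm q < 1\<close>)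
    then show "q \<noteq> 0 \<Longrightarrow> \<theta> k l \<gamma> q = (\<Sum>\<^sub>\<infinity>j. \<gamma> powi j * q powi M k l j)"
      unfolding \<theta>_def by (rule sums_unique[symmetric])
    show "(\<lambda>n. theta_coeff k l \<gamma> n * q ^ n) sums \<theta> k l \<gamma> q"
    proof (cases "q = 0")
      case True
      then show ?thesis using powser_sums_zero[of "theta_coeff k l \<gamma>"] by (simp add: \<theta>_def sums_iff)
    next
      case False
      then show ?thesis unfolding \<theta>_def using * sums_unique by metis
    qed
  qed
  have disc: "\<forall>\<^sub>F q in nhds 0. norm (q :: complex) < 1"
    using eventually_nhds_in_open[of "ball (0::complex) 1" 0] by simp
  have "(\<lambda>q. H \<gamma>1 \<gamma>2 k1 l1 k2 l2 q * \<theta> k1 l1 (- \<gamma>1) q) has_fps_expansion ?S * ?A"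
  proof (intro has_fps_expansion_mult has_fps_expansionI)
    show "\<forall>\<^sub>F q in nhds 0. (\<lambda>n. fps_nth ?S n * q ^ n) sums H \<gamma>1 \<gamma>2 k1 l1 k2 l2 q"
      by (rule eventually_mono[OF disc]) (use sums_s[OF g kl1(1,2) kl2(1,2)] in simp)
    show "\<forall>\<^sub>F q in nhds 0. (\<lambda>n. fps_nth ?A n * q ^ n) sums \<theta> k1 l1 (- \<gamma>1) q"
      by (rule eventually_mono[OF disc]) (use \<theta>(1)[OF kl1] g in auto)
  qed
  moreover have "\<theta> k2 l2 \<gamma>2 has_fps_expansion ?B"
    by (intro has_fps_expansionI eventually_mono[OF disc]) (use \<theta>(1)[OF kl2] g in auto)
  moreover have "\<forall>\<^sub>F q in at 0. H \<gamma>1 \<gamma>2 k1 l1 k2 l2 q * \<theta> k1 l1 (- \<gamma>1) q = \<theta> k2 l2 \<gamma>2 q"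
    unfolding eventually_at_filter
    by (rule eventually_mono[OF disc])
       (use H_mult_theta \<theta>(2)[OF kl1, of "- \<gamma>1"] \<theta>(2)[OF kl2 g(2)] g in auto)
  ultimately show ?thesis by (rule fps_expansion_unique_punctured)
qed

text \<open>The coefficient of \<open>q ^ n\<close> in \<open>H * \<Theta>\<^sub>1 = \<Theta>\<^sub>2\<close>, with the Cauchy product regrouped by \<open>j\<close>.\<close>

lemma sum_s_shifted_eq_theta_coeff:
  "(\<Sum>j | M k1 l1 j \<le> int n. (- \<gamma>1) powi j * s \<gamma>1 \<gamma>2 k1 l1 k2 l2 (int n - M k1 l1 j)) = theta_coeff k2 l2 \<gamma>2 n"
proof -
  let ?s = "s \<gamma>1 \<gamma>2 k1 l1 k2 l2"
  let ?J = "\<lambda>i. {j. M k1 l1 j = int i}"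
  have fin: "finite (?J i)" for i
    by (rule finite_subset[OF _ finite_M_le[OF kl1(1,2), of "int i"]]) auto
  have "theta_coeff k2 l2 \<gamma>2 n = (\<Sum>i\<le>n. theta_coeff k1 l1 (- \<gamma>1) i * ?s (int (n - i)))"
    using arg_cong[OF fps_s_mult_theta, of "\<lambda>F. fps_nth F n"]
    by (simp add: mult.commute[of "Abs_fps (\<lambda>n. ?s (int n))"] fps_mult_nth atLeast0AtMost)
  also have "\<dots> = (\<Sum>i\<le>n. \<Sum>j\<in>?J i. (- \<gamma>1) powi j * ?s (int n - M k1 l1 j))"
    unfolding theta_coeff_def sum_distrib_right by (intro sum.cong) (auto simp: of_nat_diff)
  also have "\<dots> = (\<Sum>j\<in>(\<Union>i\<in>{..n}. ?J i). (- \<gamma>1) powi j * ?s (int n - M k1 l1 j))"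
    by (rule sum.UNION_disjoint[symmetric]) (use fin in auto)
  also have "(\<Union>i\<in>{..n}. ?J i) = {j. M k1 l1 j \<le> int n}"
    using M_nonneg[OF kl1(1,2)] by (auto intro!: bexI[of _ "nat (M k1 l1 j)" for j])
  finally show ?thesis ..
qed

end

theorem theorem3p1:
  fixes \<gamma>1 \<gamma>2 :: complex and k1 l1 k2 l2 n :: int
  assumes "\<gamma>1 \<in> {1, - 1}" and "\<gamma>2 \<in> {1, - 1}"
    and "0 < k1" and "0 < l1" and "l1 < k1" and "real_of_int l1 \<noteq> real_of_int k1 / 2"
    and "0 < k2" and "0 < l2" and "l2 < k2" and "real_of_int l2 \<noteq> real_of_int k2 / 2"
    and "0 < n"
  shows "(\<forall>i. n = M k2 l2 i \<longrightarrow>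
            s \<gamma>1 \<gamma>2 k1 l1 k2 l2 n =
              (\<Sum>\<^sub>\<infinity>j\<in>UNIV - {0}. - ((- \<gamma>1) powi j) * s \<gamma>1 \<gamma>2 k1 l1 k2 l2 (n - M k1 l1 j)) + \<gamma>2 powi i) \<and>
         ((\<nexists>i. n = M k2 l2 i) \<longrightarrow>
            s \<gamma>1 \<gamma>2 k1 l1 k2 l2 n =
              (\<Sum>\<^sub>\<infinity>j\<in>UNIV - {0}. - ((- \<gamma>1) powi j) * s \<gamma>1 \<gamma>2 k1 l1 k2 l2 (n - M k1 l1 j)))"
proof -
  let ?s = "s \<gamma>1 \<gamma>2 k1 l1 k2 l2"
  define J where "J = {j. M k1 l1 j \<le> n}"
  have kl: "2 * l1 \<noteq> k1" "2 * l2 \<noteq> k2" using assms(6,10) by auto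
  have J: "finite J" "0 \<in> J"
    using finite_M_le[of l1 k1 n] assms by (simp_all add: J_def M_def)
  have "(\<Sum>\<^sub>\<infinity>j\<in>UNIV - {0}. - ((- \<gamma>1) powi j) * ?s (n - M k1 l1 j)) =
      (\<Sum>\<^sub>\<infinity>j\<in>J - {0}. - ((- \<gamma>1) powi j) * ?s (n - M k1 l1 j))"
    by (rule infsum_cong_neutral) (auto simp: J_def s_def)
  also have "\<dots> = - (\<Sum>j\<in>J - {0}. (- \<gamma>1) powi j * ?s (n - M k1 l1 j))"
    using J by (simp add: sum_negf)
  also have "\<dots> = ?s n - (\<Sum>j\<in>J. (- \<gamma>1) powi j * ?s (n - M k1 l1 j))"
    using J by (simp add: sum.remove M_def)
  also have "(\<Sum>j\<in>J. (- \<gamma>1) powi j * ?s (n - M k1 l1 j)) = theta_coeff k2 l2 \<gamma>2 (nat n)"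
    using sum_s_shifted_eq_theta_coeff[of \<gamma>1 \<gamma>2 l1 k1 l2 k2 "nat n"] assms kl by (simp add: J_def)
  finally have rec: "?s n = (\<Sum>\<^sub>\<infinity>j\<in>UNIV - {0}. - ((- \<gamma>1) powi j) * ?s (n - M k1 l1 j))
      + theta_coeff k2 l2 \<gamma>2 (nat n)" by simp
  show ?thesis
  proof (intro conjI allI impI)
    fix i assume "n = M k2 l2 i"
    then show "?s n = (\<Sum>\<^sub>\<infinity>j\<in>UNIV - {0}. - ((- \<gamma>1) powi j) * ?s (n - M k1 l1 j)) + \<gamma>2 powi i"
      using rec theta_coeff_M[of l2 k2 \<gamma>2 i] assms kl by simp
  next
    assume "\<nexists>i. n = M k2 l2 i"
    then have "{j. M k2 l2 j = int (nat n)} = {}" using assms by auto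
    then have "theta_coeff k2 l2 \<gamma>2 (nat n) = 0" by (simp add: theta_coeff_def)
    then show "?s n = (\<Sum>\<^sub>\<infinity>j\<in>UNIV - {0}. - ((- \<gamma>1) powi j) * ?s (n - M k1 l1 j))"
      using rec by simp
  qed
qed

end
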